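(* Let $d\ge1$ and $\delta>0$. Suppose that Assumptions 1 and 2 (stated in the context) hold for $S_z$ for each $z\in[z_c-\delta,z_c)$, suppose that $m_z\to0$ as $z\to z_c$, and suppose that there are constants $M,K_{\mathrm{IR}},\zeta$ such that $(J_z^{(\mu)},h_z^{(\mu)})\in\mathcal{Q}_{M,K_{\mathrm{IR}},\zeta}$ uniformly in $\mu\in\overline\Omega_z$ and in $z\in[z_c-\delta,z_c)$. Then, in the limit $z\to z_c$, $$|x|_z=\|x\|_2\bigl[1+O(m_z^{\zeta\wedge2})\bigr]$$ uniformly in $x\in\mathbb{R}^d$.
   Context: Notation. $|x|=\|x\|_2$ is the Euclidean norm on $\mathbb{R}^d$; $\hat x=x/|x|$ for $x\ne0$; $a\wedge b=\min\{a,b\}$; $e_1,\dots,e_d$ is the standard basis; $\mathbb{T}^d$ is the $d$-dimensional torus of period $2\pi$. For $f,g:\mathbb{Z}^d\to\mathbb{R}$: $\hat f(k)=\sum_{x}f(x)e^{-ik\cdot x}$, $(f*g)(x)=\sum_{y}f(x-y)g(y)$, and $\|f(y)\|_p$ is the $\ell^p(\mathbb{Z}^d)$ norm. $f$ is $\mathbb{Z}^d$-symmetric if $f(x)$ is unchanged when a component of $x$ is multiplied by $-1$ or the components of $x$ are permuted. The exponential tilt of $f$ by $\mu\in\mathbb{R}^d$ is $f^{(\mu)}(x)=f(x)e^{\mu\cdot x}$. Class $\mathcal{Q}_{M,K_{\mathrm{IR}},\zeta}$ (for $d\ge1$, $M,K_{\mathrm{IR}},\zeta>0$): the set of pairs $(Q,g)$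 of functions $\mathbb{Z}^d\to\mathbb{R}$ such that (a) $\|Q(y)\|_1\le M$ and $\||y|^{2+\zeta}Q(y)\|_1\le M$; (b) $\mathrm{Re}[\hat Q(0)-\hat Q(k)]\ge K_{\mathrm{IR}}|k|^2$ for $k\in\mathbb{T}^d$ (represented in $[-\pi,\pi]^d$); (c) $\|g(y)\|_1\le M$, $\||y|^{\zeta}g(y)\|_1\le M$, $\||y|^2g(y)\|_{p_d\wedge2}\le M$, where $p_d=2$ for $d=1$ and $p_d=\frac{d}{d-2+(\zeta\wedge2)}$ for $d\ge2$; (d) if $d\ge4$, additionally $\||y|^{d-1}Q(y)\|_{\frac d3\wedge2}\le M$ and $\||y|^{d-1}g(y)\|_2\le M$. Setting: $(S_z)$ is a family of functions $S_z:\mathbb{Z}^d\to[0,\infty)$ indexed by a real parameter $z$ near and below a real number $z_c$, with $S_z=h_z+J_z*S_z$. For each $z$, let $\chi^{(\mu)}(z)=\sum_xS_z^{(\mu)}(x)$, $\Omega_z=\{\mu\in\mathbb{R}^d:\chi^{(\mu)}(z)<\infty\}$ with closure $\overline\Omega_z$, and $m_z=\sup\{t\ge0:\chi^{(te_1)}(z)<\infty\}$. Assumption 1 for $S_z$: $S_z$ is $\mathbb{Z}^d$-symmetric, $\Omega_z$ is an open set containing $0$, and $\mu_1e_1\notin\Omega_z$ for some $\mu_1>0$. Assumption 2 for $S_z$: $S_z=h_z+J_z*S_z$ with $\mathbb{Z}^d$-symmetric $J_z,h_z\in\ell^1(\mathbb{Z}^d)$; there are constants such that $(J_z^{(\mu)},h_z^{(\mu)})\in\mathcal{Q}_{M,K_{\mathrm{IR}},\zeta}$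 for all $\mu\in\overline\Omega_z$; and $\hat h_z^{(\mu)}(0)>0$ for all $\mu\in\overline\Omega_z$. Under these assumptions, for each nonzero $x\in\mathbb{R}^d$ the maximum $\max_{\mu\in\overline\Omega_z}\mu\cdot x$ is attained at a unique point $\mu_{\hat x,z}$; the norm $|\cdot|_z$ is defined by $|x|_z=\mu_{\hat x,z}\cdot x/m_z$ for $x\neq0$ and $|0|_z=0$. *)

theory Defs
  imports "HOL-Analysis.Analysis"
begin

text \<open>
  The lattice is \<^typ>\<open>int ^ 'd\<close>, its ambient space is \<^typ>\<open>real ^ 'd\<close>, and the dimension is
  \<open>CARD('d)\<close>, which is at least 1. The index type carries no order; the index playing the role of the
  first coordinate is an explicit parameter \<open>i1\<close>, so that \<open>e\<^sub>1\<close> is \<open>axis i1 1\<close>.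
\<close>

definition emb :: "int ^ 'd \<Rightarrow> real ^ 'd" where
  "emb x = (\<chi> i. real_of_int (x $ i))"

text \<open>The norm is extended-valued, so that a bound on it includes finiteness.\<close>

definition lp_norm :: "real \<Rightarrow> (int ^ 'd \<Rightarrow> real) \<Rightarrow> ennreal" where
  "lp_norm p f =
     (if (\<lambda>y. \<bar>f y\<bar> powr p) summable_on UNIV
      then ennreal ((\<Sum>\<^sub>\<infinity>y. \<bar>f y\<bar> powr p) powr (1 / p)) else \<infinity>)"

definition fourier :: "(int ^ 'd \<Rightarrow> real) \<Rightarrow> real ^ 'd \<Rightarrow> complex" where
  "fourier f k = (\<Sum>\<^sub>\<infinity>x. complex_of_real (f x) * exp (- \<i> * complex_of_real (k \<bullet> emb x)))"

definition conv :: "(int ^ 'd \<Rightarrow> real) \<Rightarrow> (int ^ 'd \<Rightarrow> real) \<Rightarrow> int ^ 'd \<Rightarrow> real" where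
  "conv f g x = (\<Sum>\<^sub>\<infinity>y. f (x - y) * g y)"

definition lattice_symmetric :: "(int ^ 'd \<Rightarrow> real) \<Rightarrow> bool" where
  "lattice_symmetric f \<longleftrightarrow>
     (\<forall>x i. f (\<chi> j. if j = i then - (x $ j) else x $ j) = f x) \<and>
     (\<forall>x \<pi>. bij \<pi> \<longrightarrow> f (\<chi> j. x $ \<pi> j) = f x)"

definition tilt :: "real ^ 'd \<Rightarrow> (int ^ 'd \<Rightarrow> real) \<Rightarrow> int ^ 'd \<Rightarrow> real" where
  "tilt \<mu> f x = f x * exp (\<mu> \<bullet> emb x)"

definition p_exp :: "nat \<Rightarrow> real \<Rightarrow> real" where
  "p_exp d \<zeta> = (if d = 1 then 2 else real d / (real d - 2 + min \<zeta> 2))"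

definition class_Q ::
    "real \<Rightarrow> real \<Rightarrow> real \<Rightarrow> ((int ^ 'd \<Rightarrow> real) \<times> (int ^ 'd \<Rightarrow> real)) set" where
  "class_Q M K \<zeta> = {(Q, g).
     lp_norm 1 Q \<le> ennreal M \<and>
     lp_norm 1 (\<lambda>y. norm (emb y) powr (2 + \<zeta>) * Q y) \<le> ennreal M \<and>
     (\<forall>k. (\<forall>i. - pi \<le> k $ i \<and> k $ i \<le> pi) \<longrightarrow>
        Re (fourier Q 0 - fourier Q k) \<ge> K * (norm k)\<^sup>2) \<and>
     lp_norm 1 g \<le> ennreal M \<and>
     lp_norm 1 (\<lambda>y. norm (emb y) powr \<zeta> * g y) \<le> ennreal M \<and>
     lp_norm (min (p_exp CARD('d) \<zeta>) 2) (\<lambda>y. (norm (emb y))\<^sup>2 * g y) \<le> ennreal M \<and>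
     (CARD('d) \<ge> 4 \<longrightarrow>
        lp_norm (min (real CARD('d) / 3) 2) (\<lambda>y. norm (emb y) ^ (CARD('d) - 1) * Q y)
          \<le> ennreal M \<and>
        lp_norm 2 (\<lambda>y. norm (emb y) ^ (CARD('d) - 1) * g y) \<le> ennreal M)}"

text \<open>The following are meant for nonnegative \<open>S\<close>; note that \<^const>\<open>ennreal\<close> truncates negative
  numbers to 0.\<close>

definition chi :: "(int ^ 'd \<Rightarrow> real) \<Rightarrow> real ^ 'd \<Rightarrow> ennreal" where
  "chi S \<mu> = (\<Sum>\<^sub>\<infinity>x. ennreal (tilt \<mu> S x))"

definition Omega :: "(int ^ 'd \<Rightarrow> real) \<Rightarrow> (real ^ 'd) set" where
  "Omega S = {\<mu>. chi S \<mu> < \<infinity>}"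

text \<open>A real supremum: for nonnegative \<open>S\<close> satisfying \<open>assumption1\<close> below, the set contains 0 and
  is bounded above.\<close>

definition mass :: "'d \<Rightarrow> (int ^ 'd \<Rightarrow> real) \<Rightarrow> real" where
  "mass i1 S = Sup {t. 0 \<le> t \<and> chi S (t *\<^sub>R axis i1 1) < \<infinity>}"

definition assumption1 :: "'d \<Rightarrow> (int ^ 'd \<Rightarrow> real) \<Rightarrow> bool" where
  "assumption1 i1 S \<longleftrightarrow>
     lattice_symmetric S \<and> open (Omega S) \<and> 0 \<in> Omega S \<and>
     (\<exists>\<mu>1>0. \<mu>1 *\<^sub>R axis i1 1 \<notin> Omega S)"

text \<open>\<open>fourier (tilt \<mu> h) 0\<close> is the sum of a real function, hence real; the real part only adjusts
  the type.\<close>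

definition assumption2 ::
    "(int ^ 'd \<Rightarrow> real) \<Rightarrow> (int ^ 'd \<Rightarrow> real) \<Rightarrow> (int ^ 'd \<Rightarrow> real) \<Rightarrow> bool" where
  "assumption2 S J h \<longleftrightarrow>
     (\<forall>x. S x = h x + conv J S x) \<and>
     lattice_symmetric J \<and> lattice_symmetric h \<and>
     lp_norm 1 J < \<infinity> \<and> lp_norm 1 h < \<infinity> \<and>
     (\<exists>M>0. \<exists>K>0. \<exists>\<zeta>>0. \<forall>\<mu>\<in>closure (Omega S). (tilt \<mu> J, tilt \<mu> h) \<in> class_Q M K \<zeta>) \<and>
     (\<forall>\<mu>\<in>closure (Omega S). Re (fourier (tilt \<mu> h) 0) > 0)"

text \<open>The maximiser depends only on the direction \<open>sgn x = x / |x|\<close>. Under the assumptions above it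
  is unique, so the choice inherent in \<^const>\<open>arg_max_on\<close> is immaterial.\<close>

definition mu_dir :: "(int ^ 'd \<Rightarrow> real) \<Rightarrow> real ^ 'd \<Rightarrow> real ^ 'd" where
  "mu_dir S u = arg_max_on (\<lambda>\<mu>. \<mu> \<bullet> u) (closure (Omega S))"

definition norm_S :: "'d \<Rightarrow> (int ^ 'd \<Rightarrow> real) \<Rightarrow> real ^ 'd \<Rightarrow> real" where
  "norm_S i1 S x = (if x = 0 then 0 else (mu_dir S (sgn x) \<bullet> x) / mass i1 S)"

end

theory Submission
  imports Defs
begin

text \<open>
  At a boundary point \<open>\<mu>\<close> of \<open>\<Omega>\<close> the susceptibility diverges, and \<open>\<chi>(\<mu>) (1 - F(\<mu>))\<close> stays bounded, where
  \<open>F(\<mu>)\<close> is the total mass of the tilted \<open>J\<close>; hence \<open>F = 1\<close> on the boundary. By symmetry \<open>F\<close> is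
  the sum of \<open>J(y) cosh(\<mu>\<cdot>y)\<close>, and the moment bound, which holds uniformly in the tilt, gives
  \<open>F(\<mu>) = F(0) + \<sigma>|\<mu>|\<^sup>2/2 + O(|\<mu>|\<^bsup>2+a\<^esup>)\<close> with \<open>a = min \<zeta> 2\<close>. The infrared bound at small \<open>k\<close> yields
  \<open>\<sigma> \<ge> 2K\<close>. Comparing any boundary point with the boundary point \<open>m e\<^sub>1\<close> gives \<open>|\<mu>| = m (1 + O(m\<^sup>a))\<close>. The
  maximiser defining \<open>|x|\<^sub>z\<close> lies on the boundary, which bounds \<open>|x|\<^sub>z\<close> from above by Cauchy-Schwarz; the
  boundary point in direction \<open>x\<close> bounds it from below.
\<close>

subsection \<open>Taylor remainders and infinite sums\<close>

text \<open>The fourth-order Maclaurin remainder is cosh s * t^4 / 24 with |s| <= |t|. For |t| <= 1,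
  \<open>a \<le> 2\<close> gives t^4 <= |t|^(2+a); for larger |t| the left side is already at most
  cosh t. The factor cosh t stays on the right because it will be absorbed into the tilts by \<mu>
  and -\<mu>.\<close>

lemma cosh_taylor_bound:
  fixes t a :: real
  assumes "0 \<le> a" "a \<le> 2"
  shows "\<bar>cosh t - 1 - t\<^sup>2 / 2\<bar> \<le> \<bar>t\<bar> powr (2 + a) * cosh t"
proof -
  define df :: "nat \<Rightarrow> real \<Rightarrow> real" where "df m = (if even m then cosh else sinh)" for m
  have deriv: "\<forall>m x. DERIV (df m) x :> df (Suc m) x"
    by (auto simp: df_def intro!: derivative_eq_intros)
  have "df 0 = cosh" by (simp add: df_def)
  from Maclaurin_all_le[OF this deriv, of t 4]
  obtain s where s: "\<bar>s\<bar> \<le> \<bar>t\<bar>"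
    and eq: "cosh t = (\<Sum>m<4. (df m 0 / fact m) * t ^ m) + (df 4 s / fact 4) * t ^ 4"
    by blast
  have four: "{..<4} = {0, 1, 2, 3 :: nat}" by auto
  have eq': "cosh t - 1 - t\<^sup>2 / 2 = cosh s * t ^ 4 / 24"
    unfolding eq four by (simp add: df_def fact_numeral)
  have cs: "cosh s \<le> cosh t"
    using s by (metis abs_ge_zero cosh_real_abs cosh_real_nonneg_le_iff)
  have nonneg: "cosh t - 1 - t\<^sup>2 / 2 \<ge> 0"
    unfolding eq' by simp
  show ?thesis
  proof (cases "\<bar>t\<bar> \<le> 1")
    case True
    have "t ^ 4 = \<bar>t\<bar> powr 4"
      by (cases "t = 0") (auto simp: powr_realpow[symmetric, of "\<bar>t\<bar>" 4, simplified])
    also have "\<dots> \<le> \<bar>t\<bar> powr (2 + a)"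
      using True assms by (intro powr_mono') auto
    finally have *: "t ^ 4 \<le> \<bar>t\<bar> powr (2 + a)" .
    have "cosh s * t ^ 4 / 24 \<le> cosh s * t ^ 4" by simp
    also have "\<dots> \<le> cosh t * \<bar>t\<bar> powr (2 + a)"
      using cs * by (intro mult_mono) auto
    finally show ?thesis using nonneg by (simp add: eq'[symmetric] mult.commute)
  next
    case False
    have "1 \<le> \<bar>t\<bar> powr (2 + a)"
      using False assms by (intro ge_one_powr_ge_zero) auto
    then have "1 * cosh t \<le> \<bar>t\<bar> powr (2 + a) * cosh t"
      by (intro mult_right_mono) auto
    then show ?thesis using nonneg zero_le_power2[of t] by linarith
  qed
qed

text \<open>Again a fourth-order remainder for |t| <= 1. For |t| > 1 the quantities 1 - cos t <= 2
  and t^2/2 are compared with |t|^(2+a) directly, and 3 is a generous constant.\<close>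

lemma cos_taylor_bound:
  fixes t a :: real
  assumes "0 \<le> a" "a \<le> 2"
  shows "\<bar>1 - cos t - t\<^sup>2 / 2\<bar> \<le> 3 * \<bar>t\<bar> powr (2 + a)"
proof (cases "\<bar>t\<bar> \<le> 1")
  case True
  obtain s where eq: "cos t = (\<Sum>m<4. cos_coeff m * t ^ m) + (cos (s + 1/2 * real 4 * pi) / fact 4) * t ^ 4"
    using Maclaurin_cos_expansion[of t 4] by auto
  have four: "{..<4} = {0, 1, 2, 3 :: nat}" by auto
  have "1 - cos t - t\<^sup>2 / 2 = - (cos (s + 2 * pi) * t ^ 4 / 24)"
    unfolding eq four by (simp add: cos_coeff_def fact_numeral)
  then have "\<bar>1 - cos t - t\<^sup>2 / 2\<bar> = \<bar>cos s\<bar> * (t ^ 4) / 24" by (simp add: abs_mult)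
  also have "\<dots> \<le> t ^ 4"
    using mult_right_mono[OF abs_cos_le_one[of s], of "t ^ 4"] by simp (smt (verit) zero_le_even_power even_numeral)
  also have "t ^ 4 = \<bar>t\<bar> powr 4"
    by (cases "t = 0") (auto simp: powr_realpow[symmetric, of "\<bar>t\<bar>" 4, simplified])
  also have "\<dots> \<le> \<bar>t\<bar> powr (2 + a)"
    using True assms by (intro powr_mono') auto
  also have "\<dots> \<le> 3 * \<bar>t\<bar> powr (2 + a)" by simp
  finally show ?thesis .
next
  case False
  have 1: "1 \<le> \<bar>t\<bar> powr (2 + a)"
    using False assms by (intro ge_one_powr_ge_zero) auto
  have "\<bar>t\<bar> powr 2 \<le> \<bar>t\<bar> powr (2 + a)"
    using False assms by (intro powr_mono) auto
  then have 2: "t\<^sup>2 \<le> \<bar>t\<bar> powr (2 + a)"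
    using False by (simp add: powr_realpow[symmetric, of "\<bar>t\<bar>" 2, simplified])
  show ?thesis
    using 1 2 cos_le_one[of t] cos_ge_minus_one[of t] zero_le_power2[of t] by linarith
qed

lemma infsum_dominated:
  fixes f g :: "'a \<Rightarrow> real"
  assumes "g summable_on A" and "\<And>x. x \<in> A \<Longrightarrow> \<bar>f x\<bar> \<le> g x"
  shows "f summable_on A" and "\<bar>infsum f A\<bar> \<le> infsum g A"
proof -
  have abs: "(\<lambda>x. norm (f x)) summable_on A"
    using Infinite_Sum.abs_summable_on_comparison_test'[OF assms(1), of f] assms(2) by simp
  then show sf: "f summable_on A" using summable_on_iff_abs_summable_on_real by blast
  have "\<bar>infsum f A\<bar> \<le> infsum (\<lambda>x. \<bar>f x\<bar>) A"
    using norm_infsum_bound[OF abs] by simp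
  also have "\<dots> \<le> infsum g A"
    using abs assms by (intro infsum_mono) auto
  finally show "\<bar>infsum f A\<bar> \<le> infsum g A" .
qed

subsection \<open>Lattice symmetries and exponential tilts\<close>

text \<open>Flipping a whole set of coordinates covers three uses at once: a single sign change, the
  central reflection (\<open>A = UNIV\<close>), and the reflection in all coordinates but one, whose
  average with the identity projects onto an axis.\<close>

definition reflect :: "'d set \<Rightarrow> 'a::uminus ^ 'd \<Rightarrow> 'a ^ 'd" where
  "reflect A x = (\<chi> i. if i \<in> A then - (x $ i) else x $ i)"

lemma reflect_reflect [simp]:
  fixes x :: "'a::group_add ^ 'd"
  shows "reflect A (reflect A x) = x"
  by (simp add: reflect_def vec_eq_iff)

lemma bij_reflect: "bij (reflect A :: 'a::group_add ^ 'd \<Rightarrow> 'a ^ 'd)"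
  by (rule o_bij[of "reflect A"]) (auto simp: fun_eq_iff)

lemma reflect_UNIV: "reflect UNIV x = (- x :: 'a::group_add ^ 'd)"
  by (simp add: reflect_def vec_eq_iff)

lemma emb_reflect: "emb (reflect A x) = reflect A (emb x)"
  by (simp add: emb_def reflect_def vec_eq_iff)

lemma emb_uminus [simp]: "emb (- x) = - emb x"
  by (simp add: emb_def vec_eq_iff)

lemma inner_reflect: "reflect A x \<bullet> reflect A y = (x :: real ^ 'd) \<bullet> y"
  by (auto simp: inner_vec_def reflect_def intro!: sum.cong)

lemma lattice_symmetric_reflect:
  fixes f :: "int ^ 'd \<Rightarrow> real"
  assumes "lattice_symmetric f"
  shows "f (reflect A x) = f x"
proof -
  have "finite A" by simp
  then show ?thesis
  proof (induction A arbitrary: x)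
    case empty
    have "reflect {} x = x" by (simp add: reflect_def vec_eq_iff)
    then show ?case by simp
  next
    case (insert i A)
    have "reflect (insert i A) x = (\<chi> j. if j = i then - (reflect A x $ j) else reflect A x $ j)"
      using insert.hyps by (auto simp: reflect_def vec_eq_iff)
    also have "f \<dots> = f (reflect A x)"
      using assms unfolding lattice_symmetric_def by blast
    finally show ?case using insert.IH by simp
  qed
qed

lemma tilt_reflect:
  assumes "lattice_symmetric f"
  shows "tilt (reflect A \<mu>) f x = tilt \<mu> f (reflect A x)"
proof -
  have "reflect A \<mu> \<bullet> emb x = \<mu> \<bullet> emb (reflect A x)"
    using inner_reflect[of A \<mu> "emb (reflect A x)"] by (simp add: emb_reflect)
  then show ?thesis
    using lattice_symmetric_reflect[OF assms, of A x] by (simp add: tilt_def)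
qed

definition permute :: "('d \<Rightarrow> 'd) \<Rightarrow> 'a ^ 'd \<Rightarrow> 'a ^ 'd" where
  "permute \<pi> x = (\<chi> j. x $ \<pi> j)"

lemma permute_inv:
  assumes "bij \<pi>"
  shows "permute (inv \<pi>) (permute \<pi> x) = x" "permute \<pi> (permute (inv \<pi>) x) = x"
  using assms by (auto simp: permute_def vec_eq_iff bij_is_inj bij_is_surj surj_f_inv_f)

lemma bij_permute:
  assumes "bij \<pi>"
  shows "bij (permute \<pi> :: 'a ^ 'd \<Rightarrow> 'a ^ 'd)"
  using permute_inv[OF assms] by (intro o_bij[of "permute (inv \<pi>)"]) (auto simp: fun_eq_iff)

lemma inner_permute:
  assumes "bij \<pi>"
  shows "permute \<pi> x \<bullet> permute \<pi> y = (x :: real ^ 'd) \<bullet> y"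
  unfolding inner_vec_def permute_def
  using sum.reindex_bij_betw[OF assms, of "\<lambda>j. x $ j * y $ j"] by simp

lemma tilt_permute:
  assumes "lattice_symmetric f" "bij \<pi>"
  shows "tilt (permute \<pi> \<mu>) f (permute \<pi> x) = tilt \<mu> f x"
proof -
  have "emb (permute \<pi> x) = permute \<pi> (emb x)" by (simp add: emb_def permute_def vec_eq_iff)
  moreover have "f (permute \<pi> x) = f x"
    using assms unfolding lattice_symmetric_def permute_def by blast
  ultimately show ?thesis by (simp add: tilt_def inner_permute[OF assms(2)])
qed

subsection \<open>Convexity and symmetry of the domain\<close>

text \<open>The extended-valued sum is the supremum of the finite partial sums, so its finiteness is
  ordinary summability. From here on the susceptibility is handled as a real sum.\<close>

lemma Omega_iff_summable:
  assumes "\<And>x. S x \<ge> 0"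
  shows "\<mu> \<in> Omega S \<longleftrightarrow> tilt \<mu> S summable_on UNIV"
proof -
  have nn: "tilt \<mu> S x \<ge> 0" for x using assms by (simp add: tilt_def)
  have chi: "chi S \<mu> = (SUP F\<in>{F. finite F}. \<Sum>x\<in>F. ennreal (tilt \<mu> S x))"
    unfolding chi_def by (subst nonneg_infsum_complete) auto
  show ?thesis
  proof
    assume "tilt \<mu> S summable_on UNIV"
    then have "chi S \<mu> = ennreal (infsum (tilt \<mu> S) UNIV)"
      unfolding chi using nn
      by (subst infsum_nonneg_is_SUPREMUM_ennreal) (auto simp: sum_ennreal)
    then show "\<mu> \<in> Omega S" by (simp add: Omega_def)
  next
    assume "\<mu> \<in> Omega S"
    then have fin: "chi S \<mu> < \<infinity>" by (simp add: Omega_def)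
    show "tilt \<mu> S summable_on UNIV"
    proof (rule nonneg_bdd_above_summable_on)
      show "bdd_above (sum (tilt \<mu> S) ` {F. F \<subseteq> UNIV \<and> finite F})"
      proof (rule bdd_aboveI2)
        fix F :: "(int ^ 'a) set" assume "F \<in> {F. F \<subseteq> UNIV \<and> finite F}"
        then have "ennreal (sum (tilt \<mu> S) F) \<le> chi S \<mu>"
          unfolding chi using nn by (intro SUP_upper2[of F]) (auto simp: sum_ennreal)
        then have "ennreal (sum (tilt \<mu> S) F) \<le> ennreal (enn2real (chi S \<mu>))"
          using fin by simp
        then show "sum (tilt \<mu> S) F \<le> enn2real (chi S \<mu>)"
          by (simp add: ennreal_le_iff)
      qed
    qed (use nn in auto)
  qed
qed

text \<open>Convexity of exp dominates the tilt at a convex combination pointwise by the convex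
  combination of the tilts.\<close>

lemma convex_Omega:
  assumes "\<And>x. S x \<ge> 0"
  shows "convex (Omega S)"
proof (rule convexI)
  fix a b u v assume ab: "a \<in> Omega S" "b \<in> Omega S"
    and uv: "(0::real) \<le> u" "0 \<le> v" "u + v = 1"
  have "(\<lambda>x. u * tilt a S x + v * tilt b S x) summable_on UNIV"
    using ab Omega_iff_summable[of S, OF assms]
    by (intro summable_on_add summable_on_cmult_right) auto
  then have "tilt (u *\<^sub>R a + v *\<^sub>R b) S summable_on UNIV"
  proof (rule summable_on_comparison_test)
    fix x
    have "exp (u *\<^sub>R (a \<bullet> emb x) + v *\<^sub>R (b \<bullet> emb x)) \<le> u * exp (a \<bullet> emb x) + v * exp (b \<bullet> emb x)"
      using uv exp_convex unfolding convex_on_def by (simp add: real_scaleR_def)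
    from mult_left_mono[OF this assms[of x]]
    show "tilt (u *\<^sub>R a + v *\<^sub>R b) S x \<le> u * tilt a S x + v * tilt b S x"
      by (simp add: tilt_def inner_add_left algebra_simps)
    show "0 \<le> tilt (u *\<^sub>R a + v *\<^sub>R b) S x" using assms by (simp add: tilt_def)
  qed
  then show "u *\<^sub>R a + v *\<^sub>R b \<in> Omega S" using Omega_iff_summable[of S, OF assms] by blast
qed

lemma reflect_in_Omega:
  assumes "\<And>x. S x \<ge> 0" "lattice_symmetric S" "\<mu> \<in> Omega S"
  shows "reflect A \<mu> \<in> Omega S"
proof -
  have "(\<lambda>x. tilt \<mu> S (reflect A x)) summable_on UNIV"
    using summable_on_reindex_bij_betw[OF bij_reflect[of A], of "tilt \<mu> S"] assms
    by (simp add: Omega_iff_summable)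
  then show ?thesis
    using tilt_reflect[OF assms(2), of A \<mu>]
    by (simp add: Omega_iff_summable[OF assms(1)] fun_eq_iff[symmetric] cong: summable_on_cong)
qed

lemma permute_in_Omega:
  assumes "\<And>x. S x \<ge> 0" "lattice_symmetric S" "\<mu> \<in> Omega S" "bij \<pi>"
  shows "permute \<pi> \<mu> \<in> Omega S"
proof -
  have "(\<lambda>x. tilt (permute \<pi> \<mu>) S (permute \<pi> x)) summable_on UNIV"
    using assms by (simp add: tilt_permute Omega_iff_summable[OF assms(1)])
  then show ?thesis
    using summable_on_reindex_bij_betw[OF bij_permute[OF assms(4)], of "tilt (permute \<pi> \<mu>) S"]
    by (simp add: Omega_iff_summable[OF assms(1)])
qed

text \<open>Symmetry and convexity project \<open>\<mu>\<close> onto the first axis without leaving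
  \<open>Omega S\<close>. This lets the single number \<open>mass i1 S\<close> control every
  coordinate of every point of the domain.\<close>

lemma abs_component_axis_in_Omega:
  assumes S: "\<And>x. S x \<ge> 0" and sym: "lattice_symmetric S" and \<mu>: "\<mu> \<in> Omega S"
  shows "\<bar>\<mu> $ i\<bar> *\<^sub>R axis i1 1 \<in> Omega S"
proof -
  define \<nu> where "\<nu> = permute (Transposition.transpose i i1) \<mu>"
  have \<nu>: "\<nu> \<in> Omega S"
    unfolding \<nu>_def by (rule permute_in_Omega[OF S sym \<mu>]) simp
  \<comment> \<open>After swapping coordinates \<open>i\<close> and \<open>i1\<close>, averaging
    with the mirror image in all other coordinates cancels everything except coordinate
    \<open>i1\<close>, which holds \<open>\<mu> $ i\<close>.\<close>
  have "(1/2) *\<^sub>R \<nu> + (1/2) *\<^sub>R reflect (- {i1}) \<nu> \<in> Omega S"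
    using \<nu> reflect_in_Omega[OF S sym \<nu>] by (intro convexD[OF convex_Omega[OF S]]) auto
  moreover have "(1/2) *\<^sub>R \<nu> + (1/2) *\<^sub>R reflect (- {i1}) \<nu> = (\<mu> $ i) *\<^sub>R axis i1 1"
    by (auto simp: vec_eq_iff reflect_def axis_def \<nu>_def permute_def)
  ultimately have *: "(\<mu> $ i) *\<^sub>R axis i1 1 \<in> Omega S" by simp
  have "reflect UNIV ((\<mu> $ i) *\<^sub>R axis i1 1) \<in> Omega S"
    by (rule reflect_in_Omega[OF S sym *])
  with * show ?thesis by (auto simp: reflect_UNIV abs_if)
qed

subsection \<open>Moments\<close>

lemma has_sum_finite_sum:
  fixes f :: "'i \<Rightarrow> 'a \<Rightarrow> 'b::topological_comm_monoid_add"
  assumes "finite I" "\<And>i. i \<in> I \<Longrightarrow> (f i has_sum s i) A"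
  shows "((\<lambda>x. \<Sum>i\<in>I. f i x) has_sum (\<Sum>i\<in>I. s i)) A"
  using assms by (induction I rule: finite_induct) (auto intro!: has_sum_add)

text \<open>This follows from exp(v - u) >= 1 + (v - u). Only the two endpoint exponentials occur on
  the right, so moments are needed at the two given tilts and at no tilt in between.\<close>

lemma abs_exp_diff_le:
  fixes a b :: real
  shows "\<bar>exp a - exp b\<bar> \<le> \<bar>a - b\<bar> * (exp a + exp b)"
proof -
  have *: "exp u - exp v \<le> (u - v) * exp u" for u v :: real
  proof -
    have "exp u * (1 + (v - u)) \<le> exp u * exp (v - u)"
      by (intro mult_left_mono exp_ge_add_one_self) auto
    also have "\<dots> = exp v" by (simp add: exp_add[symmetric])
    finally show ?thesis by (simp add: algebra_simps)
  qed
  show ?thesis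
  proof (cases "b \<le> a")
    case True
    then have "(a - b) * exp a \<le> (a - b) * (exp a + exp b)" by (intro mult_left_mono) auto
    with *[of a b] have "exp a - exp b \<le> (a - b) * (exp a + exp b)" by linarith
    with True show ?thesis by simp
  next
    case False
    then have "(b - a) * exp b \<le> (b - a) * (exp a + exp b)" by (intro mult_left_mono) auto
    with *[of b a] have "exp b - exp a \<le> (b - a) * (exp a + exp b)" by linarith
    with False show ?thesis by simp
  qed
qed

text \<open>The weight combines the two \<ell>1 bounds on the first function in
  \<open>class_Q\<close>. It dominates |y|^s for every s in [0, 2 + \<zeta>], so one hypothesis
  serves the first moment, the second moment and the Taylor remainders.\<close>

definition moment_bound :: "real \<Rightarrow> real \<Rightarrow> (int ^ 'd \<Rightarrow> real) \<Rightarrow> bool" where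
  "moment_bound \<zeta> B f \<longleftrightarrow>
     (\<lambda>y. \<bar>f y\<bar> * (1 + norm (emb y) powr (2 + \<zeta>))) summable_on UNIV \<and>
     (\<Sum>\<^sub>\<infinity>y. \<bar>f y\<bar> * (1 + norm (emb y) powr (2 + \<zeta>))) \<le> B"

lemma powr_le_one_plus_powr:
  fixes r s t :: real
  assumes "0 \<le> r" "0 \<le> s" "s \<le> t"
  shows "r powr s \<le> 1 + r powr t"
proof (cases "r \<le> 1")
  case True
  then have "r powr s \<le> 1" using assms by (intro powr_le1) auto
  then show ?thesis by (smt (verit) powr_ge_zero)
next
  case False
  then have "r powr s \<le> r powr t" using assms by (intro powr_mono) auto
  then show ?thesis by simp
qed

lemma moment_bound_dominated:
  assumes "moment_bound \<zeta> B f" "0 \<le> c" "0 \<le> s" "s \<le> 2 + \<zeta>"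
    and g: "\<And>y. \<bar>g y\<bar> \<le> c * (\<bar>f y\<bar> * norm (emb y) powr s)"
  shows "g summable_on UNIV" and "\<bar>infsum g UNIV\<bar> \<le> c * B"
proof -
  have le: "\<bar>g y\<bar> \<le> c * (\<bar>f y\<bar> * (1 + norm (emb y) powr (2 + \<zeta>)))" for y
    using g[of y] powr_le_one_plus_powr[of "norm (emb y)" s "2 + \<zeta>"] assms
    by (smt (verit, best) abs_ge_zero mult_left_mono norm_ge_zero)
  have sum: "(\<lambda>y. c * (\<bar>f y\<bar> * (1 + norm (emb y) powr (2 + \<zeta>)))) summable_on UNIV"
    using assms(1) unfolding moment_bound_def by (intro summable_on_cmult_right) auto
  show "g summable_on UNIV" using infsum_dominated(1)[OF sum le] .
  have "\<bar>infsum g UNIV\<bar> \<le> c * (\<Sum>\<^sub>\<infinity>y. \<bar>f y\<bar> * (1 + norm (emb y) powr (2 + \<zeta>)))"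
    using infsum_dominated(2)[OF sum le] by (simp add: infsum_cmult_right')
  also have "\<dots> \<le> c * B"
    using assms unfolding moment_bound_def by (intro mult_left_mono) auto
  finally show "\<bar>infsum g UNIV\<bar> \<le> c * B" .
qed

lemma moment_bound_summable:
  assumes "moment_bound \<zeta> B f"
  shows "f summable_on UNIV"
  using assms unfolding moment_bound_def
  by (auto intro!: infsum_dominated(1)[of "\<lambda>y. \<bar>f y\<bar> * (1 + norm (emb y) powr (2 + \<zeta>))"] mult_left_mono
      simp: mult_le_cancel_left1)

section \<open>Second moments and the quadratic expansion of the tilted mass\<close>

lemma moment_bound_tilt_uminus:
  assumes "lattice_symmetric f" "moment_bound \<zeta> B (tilt \<mu> f)"
  shows "moment_bound \<zeta> B (tilt (- \<mu>) f)"
proof -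
  define w :: "int ^ 'a \<Rightarrow> real" where "w y = \<bar>tilt \<mu> f y\<bar> * (1 + norm (emb y) powr (2 + \<zeta>))" for y
  have eq: "(\<lambda>y. \<bar>tilt (- \<mu>) f y\<bar> * (1 + norm (emb y) powr (2 + \<zeta>))) = (\<lambda>y. w (reflect UNIV y))"
    using tilt_reflect[OF assms(1), of UNIV \<mu>] by (auto simp: w_def reflect_UNIV)
  have "w summable_on UNIV" "infsum w UNIV \<le> B"
    using assms(2) unfolding moment_bound_def w_def by auto
  then show ?thesis
    unfolding moment_bound_def eq
    using summable_on_reindex_bij_betw[OF bij_reflect[of UNIV], of w]
      infsum_reindex_bij_betw[OF bij_reflect[of UNIV], of w] by simp
qed

lemma infsum_tilt_uminus:
  assumes "lattice_symmetric f"
  shows "infsum (tilt (- \<mu>) f) UNIV = infsum (tilt \<mu> f) UNIV"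
  using infsum_reindex_bij_betw[OF bij_reflect[of UNIV], of "tilt \<mu> f"] tilt_reflect[OF assms, of UNIV \<mu>]
  by (simp add: reflect_UNIV cong: infsum_cong)

text \<open>For a symmetric function with enough moments the value is the same for all
  \<open>i\<close>: it is 1/d times the sum of f(y)|y|^2. The function may take both signs, so
  positivity has to be proved separately, in \<open>class_Q_infrared\<close>.\<close>

definition second_moment :: "'d \<Rightarrow> (int ^ 'd \<Rightarrow> real) \<Rightarrow> real" where
  "second_moment i f = (\<Sum>\<^sub>\<infinity>y. f y * (emb y $ i)\<^sup>2)"

lemma abs_inner_le_norm_powr:
  fixes \<mu> y :: "real ^ 'd"
  assumes "0 \<le> s"
  shows "\<bar>\<mu> \<bullet> y\<bar> powr s \<le> norm \<mu> powr s * norm y powr s"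
proof -
  have "\<bar>\<mu> \<bullet> y\<bar> powr s \<le> (norm \<mu> * norm y) powr s"
    using assms Cauchy_Schwarz_ineq2 by (intro powr_mono2) auto
  then show ?thesis by (simp add: powr_mult)
qed

lemma norm_powr_2: "norm x powr 2 = (norm x)\<^sup>2" for x :: "'a::real_normed_vector"
  by (metis norm_ge_zero powr_numeral)

text \<open>On the diagonal, a transposition carries coordinate \<open>i\<close> to
  \<open>i1\<close>. Off the diagonal, flipping coordinate \<open>i\<close> alone changes the sign
  of the summand, so the sum equals its own negative.\<close>

lemma has_sum_second_moments:
  assumes f: "moment_bound \<zeta> B f" and sym: "lattice_symmetric f" and "0 \<le> \<zeta>"
  shows "((\<lambda>y. f y * (emb y $ i * emb y $ j)) has_sum (if i = j then second_moment i1 f else 0)) UNIV"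
proof -
  have summ: "(\<lambda>y. f y * (emb y $ i * emb y $ j)) summable_on UNIV" for i j
  proof (rule moment_bound_dominated(1)[OF f])
    fix y
    have "\<bar>emb y $ i\<bar> * \<bar>emb y $ j\<bar> \<le> norm (emb y) * norm (emb y)"
      by (intro mult_mono component_le_norm_cart) auto
    then show "\<bar>f y * (emb y $ i * emb y $ j)\<bar> \<le> 1 * (\<bar>f y\<bar> * norm (emb y) powr 2)"
      by (simp add: abs_mult mult_left_mono norm_powr_2 power2_eq_square)
  qed (use \<open>0 \<le> \<zeta>\<close> in auto)
  have "(\<Sum>\<^sub>\<infinity>y. f y * (emb y $ i * emb y $ j)) = (if i = j then second_moment i1 f else 0)"
  proof (cases "i = j")
    case True
    define \<pi> where "\<pi> = Transposition.transpose i i1"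
    have \<pi>: "bij \<pi>" by (simp add: \<pi>_def)
    have "f (permute \<pi> y) = f y" for y
      using sym \<pi> unfolding lattice_symmetric_def permute_def by blast
    then have "(\<Sum>\<^sub>\<infinity>y. f y * (emb y $ i)\<^sup>2) = (\<Sum>\<^sub>\<infinity>y. f y * (emb y $ i1)\<^sup>2)"
      using infsum_reindex_bij_betw[OF bij_permute[OF \<pi>], of "\<lambda>y. f y * (emb y $ i)\<^sup>2"]
      by (simp add: emb_def permute_def \<pi>_def)
    with True show ?thesis by (simp add: second_moment_def power2_eq_square)
  next
    case False
    have "(\<Sum>\<^sub>\<infinity>y. f y * (emb y $ i * emb y $ j)) = (\<Sum>\<^sub>\<infinity>y. - (f y * (emb y $ i * emb y $ j)))"
      using infsum_reindex_bij_betw[OF bij_reflect[of "{i}"], of "\<lambda>y. f y * (emb y $ i * emb y $ j)"] False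
      by (simp add: lattice_symmetric_reflect[OF sym] emb_reflect) (simp add: reflect_def)
    with False show ?thesis by (simp add: infsum_uminus)
  qed
  with has_sum_infsum[OF summ[of i j]] show ?thesis by simp
qed

lemma has_sum_inner_square:
  assumes f: "moment_bound \<zeta> B f" and sym: "lattice_symmetric f" and "0 \<le> \<zeta>"
  shows "((\<lambda>y. f y * (\<mu> \<bullet> emb y)\<^sup>2) has_sum (second_moment i1 f * (norm \<mu>)\<^sup>2)) UNIV"
proof -
  have "((\<lambda>y. \<Sum>i\<in>UNIV. \<Sum>j\<in>UNIV. \<mu> $ i * \<mu> $ j * (f y * (emb y $ i * emb y $ j))) has_sum
      (\<Sum>i\<in>UNIV. \<Sum>j\<in>UNIV. \<mu> $ i * \<mu> $ j * (if i = j then second_moment i1 f else 0))) UNIV"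
    by (intro has_sum_finite_sum has_sum_cmult_right has_sum_second_moments[OF assms]) auto
  moreover have "(\<Sum>i\<in>UNIV. \<Sum>j\<in>UNIV. \<mu> $ i * \<mu> $ j * (if i = j then second_moment i1 f else 0))
      = second_moment i1 f * (norm \<mu>)\<^sup>2"
    by (simp add: power2_norm_eq_inner inner_vec_def sum_distrib_left if_distrib[of "\<lambda>x. _ * x"]
        mult.commute cong: if_cong)
  moreover have "(\<Sum>i\<in>UNIV. \<Sum>j\<in>UNIV. \<mu> $ i * \<mu> $ j * (f y * (emb y $ i * emb y $ j)))
      = f y * (\<mu> \<bullet> emb y)\<^sup>2" for y
    by (simp add: inner_vec_def power2_eq_square sum_product sum_distrib_left mult_ac)
  ultimately show ?thesis by simp
qed

lemma tilt_0 [simp]: "tilt 0 f = f"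
  by (simp add: tilt_def fun_eq_iff)

text \<open>Averaging over \<mu> and -\<mu> replaces the exponential by cosh, which removes odd
  orders. Since the moment bound is assumed at the tilt itself, the error constant \<open>B\<close>
  carries no factor that grows exponentially in \<mu>.\<close>

lemma infsum_tilt_expansion:
  assumes sym: "lattice_symmetric f"
    and f0: "moment_bound \<zeta> B f" and f\<mu>: "moment_bound \<zeta> B (tilt \<mu> f)"
    and a: "0 \<le> a" "a \<le> 2" "a \<le> \<zeta>"
  shows "\<bar>infsum (tilt \<mu> f) UNIV - infsum f UNIV - second_moment i1 f * (norm \<mu>)\<^sup>2 / 2\<bar>
    \<le> B * norm \<mu> powr (2 + a)"
proof -
  define c where "c = norm \<mu> powr (2 + a)"
  define R where "R y = f y * (cosh (\<mu> \<bullet> emb y) - 1 - (\<mu> \<bullet> emb y)\<^sup>2 / 2)" for y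
  have f\<mu>': "moment_bound \<zeta> B (tilt (- \<mu>) f)"
    by (rule moment_bound_tilt_uminus[OF sym f\<mu>])
  have "(R has_sum (infsum (tilt \<mu> f) UNIV / 2 + infsum (tilt (- \<mu>) f) UNIV / 2 - infsum f UNIV
      - second_moment i1 f * (norm \<mu>)\<^sup>2 / 2)) UNIV"
  proof -
    have "((\<lambda>y. tilt \<mu> f y * (1/2) + tilt (- \<mu>) f y * (1/2) + f y * (-1) + (f y * (\<mu> \<bullet> emb y)\<^sup>2) * (- 1/2))
       has_sum (infsum (tilt \<mu> f) UNIV * (1/2) + infsum (tilt (- \<mu>) f) UNIV * (1/2) + infsum f UNIV * (-1)
      + (second_moment i1 f * (norm \<mu>)\<^sup>2) * (-1/2))) UNIV"
      using a by (intro has_sum_add has_sum_cmult_left has_sum_infsum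
        moment_bound_summable[OF f0] moment_bound_summable[OF f\<mu>] moment_bound_summable[OF f\<mu>']
        has_sum_inner_square[OF f0 sym]) auto
    moreover have "R = (\<lambda>y. tilt \<mu> f y * (1/2) + tilt (- \<mu>) f y * (1/2) + f y * (-1) + (f y * (\<mu> \<bullet> emb y)\<^sup>2) * (- 1/2))"
      by (simp add: R_def tilt_def cosh_def field_simps fun_eq_iff)
    ultimately show ?thesis by (simp add: algebra_simps)
  qed
  then have "infsum R UNIV = infsum (tilt \<mu> f) UNIV - infsum f UNIV - second_moment i1 f * (norm \<mu>)\<^sup>2 / 2"
    by (simp add: infsumI infsum_tilt_uminus[OF sym])
  moreover have "\<bar>infsum R UNIV\<bar> \<le> c * B"
  proof -
    define w where "w g y = \<bar>g y\<bar> * (1 + norm (emb y) powr (2 + \<zeta>))" for g :: "int ^ 'a \<Rightarrow> real" and y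
    have w: "w (tilt \<nu> f) summable_on UNIV" "infsum (w (tilt \<nu> f)) UNIV \<le> B" if "\<nu> \<in> {\<mu>, - \<mu>}" for \<nu>
      using f\<mu> f\<mu>' that unfolding moment_bound_def w_def by auto
    have sw: "(\<lambda>y. (c/2) * (w (tilt \<mu> f) y + w (tilt (- \<mu>) f) y)) summable_on UNIV"
      by (intro summable_on_cmult_right summable_on_add w) auto
    \<comment> \<open>The factor cosh is half the sum of the two exponentials, so the remainder is
      controlled by the weighted sums of the two tilted functions, each bounded by
      \<open>B\<close>.\<close>
    have le: "\<bar>R y\<bar> \<le> (c/2) * (w (tilt \<mu> f) y + w (tilt (- \<mu>) f) y)" for y
    proof -
      have "\<bar>cosh (\<mu> \<bullet> emb y) - 1 - (\<mu> \<bullet> emb y)\<^sup>2 / 2\<bar> \<le> \<bar>\<mu> \<bullet> emb y\<bar> powr (2 + a) * cosh (\<mu> \<bullet> emb y)"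
        using a by (intro cosh_taylor_bound)
      also have "\<dots> \<le> (c * (1 + norm (emb y) powr (2 + \<zeta>))) * cosh (\<mu> \<bullet> emb y)"
      proof (rule mult_right_mono)
        have "\<bar>\<mu> \<bullet> emb y\<bar> powr (2 + a) \<le> c * norm (emb y) powr (2 + a)"
          unfolding c_def using a by (intro abs_inner_le_norm_powr) auto
        also have "\<dots> \<le> c * (1 + norm (emb y) powr (2 + \<zeta>))"
          unfolding c_def using a by (intro mult_left_mono powr_le_one_plus_powr) auto
        finally show "\<bar>\<mu> \<bullet> emb y\<bar> powr (2 + a) \<le> c * (1 + norm (emb y) powr (2 + \<zeta>))" .
      qed simp
      finally have "\<bar>R y\<bar> \<le> \<bar>f y\<bar> * ((c * (1 + norm (emb y) powr (2 + \<zeta>))) * cosh (\<mu> \<bullet> emb y))"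
        unfolding R_def abs_mult by (intro mult_left_mono) auto
      also have "\<dots> = (c/2) * (w (tilt \<mu> f) y + w (tilt (- \<mu>) f) y)"
        by (simp add: w_def tilt_def cosh_def abs_mult field_simps)
      finally show ?thesis .
    qed
    have "\<bar>infsum R UNIV\<bar> \<le> infsum (\<lambda>y. (c/2) * (w (tilt \<mu> f) y + w (tilt (- \<mu>) f) y)) UNIV"
      by (rule infsum_dominated(2)[OF sw le])
    also have "\<dots> = (c/2) * (infsum (w (tilt \<mu> f)) UNIV + infsum (w (tilt (- \<mu>) f)) UNIV)"
      by (subst infsum_cmult_right', subst infsum_add) (use w in auto)
    also have "\<dots> \<le> (c/2) * (B + B)"
      using w by (intro mult_left_mono add_mono) (auto simp: c_def)
    finally show ?thesis by simp
  qed
  ultimately show ?thesis by (simp add: c_def mult.commute)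
qed

text \<open>The first moments at the two tilts control the difference of the masses. The purpose is
  continuity of the mass of the tilted J up to the boundary of the domain.\<close>

lemma infsum_tilt_lipschitz:
  assumes "moment_bound \<zeta> B (tilt \<mu> f)" "moment_bound \<zeta> B (tilt \<nu> f)" "0 \<le> \<zeta>"
  shows "\<bar>infsum (tilt \<mu> f) UNIV - infsum (tilt \<nu> f) UNIV\<bar> \<le> 2 * B * norm (\<mu> - \<nu>)"
proof -
  define n where "n = norm (\<mu> - \<nu>)"
  define v where "v g y = n * (\<bar>g y\<bar> * norm (emb y) powr 1)" for g :: "int ^ 'a \<Rightarrow> real" and y
  have v: "v g summable_on UNIV" "\<bar>infsum (v g) UNIV\<bar> \<le> n * B" if "moment_bound \<zeta> B g" for g
    using assms(3) by (rule_tac moment_bound_dominated[OF that, of n 1]; simp add: v_def n_def abs_mult)+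
  have sv: "(\<lambda>y. v (tilt \<mu> f) y + v (tilt \<nu> f) y) summable_on UNIV"
    by (intro summable_on_add v assms)
  have le: "\<bar>tilt \<mu> f y - tilt \<nu> f y\<bar> \<le> v (tilt \<mu> f) y + v (tilt \<nu> f) y" for y
  proof -
    have "\<bar>exp (\<mu> \<bullet> emb y) - exp (\<nu> \<bullet> emb y)\<bar>
        \<le> \<bar>(\<mu> - \<nu>) \<bullet> emb y\<bar> * (exp (\<mu> \<bullet> emb y) + exp (\<nu> \<bullet> emb y))"
      using abs_exp_diff_le by (simp add: inner_diff_left)
    also have "\<dots> \<le> (n * norm (emb y)) * (exp (\<mu> \<bullet> emb y) + exp (\<nu> \<bullet> emb y))"
      unfolding n_def by (intro mult_right_mono Cauchy_Schwarz_ineq2 add_nonneg_nonneg) auto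
    finally have "\<bar>f y\<bar> * \<bar>exp (\<mu> \<bullet> emb y) - exp (\<nu> \<bullet> emb y)\<bar>
        \<le> \<bar>f y\<bar> * ((n * norm (emb y)) * (exp (\<mu> \<bullet> emb y) + exp (\<nu> \<bullet> emb y)))"
      by (intro mult_left_mono) auto
    moreover have "tilt \<mu> f y - tilt \<nu> f y = f y * (exp (\<mu> \<bullet> emb y) - exp (\<nu> \<bullet> emb y))"
      by (simp add: tilt_def right_diff_distrib)
    moreover have "v (tilt \<mu> f) y + v (tilt \<nu> f) y
        = \<bar>f y\<bar> * ((n * norm (emb y)) * (exp (\<mu> \<bullet> emb y) + exp (\<nu> \<bullet> emb y)))"
      by (simp add: tilt_def v_def abs_mult distrib_left mult_ac)
    ultimately show ?thesis by (simp add: abs_mult)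
  qed
  have "infsum (tilt \<mu> f) UNIV - infsum (tilt \<nu> f) UNIV = infsum (\<lambda>y. tilt \<mu> f y - tilt \<nu> f y) UNIV"
    using infsum_add[OF moment_bound_summable[OF assms(1)] iffD2[OF summable_on_uminus moment_bound_summable[OF assms(2)]]]
    by (simp add: infsum_uminus)
  then have "\<bar>infsum (tilt \<mu> f) UNIV - infsum (tilt \<nu> f) UNIV\<bar>
      \<le> infsum (\<lambda>y. v (tilt \<mu> f) y + v (tilt \<nu> f) y) UNIV"
    using infsum_dominated(2)[OF sv le] by simp
  also have "\<dots> = infsum (v (tilt \<mu> f)) UNIV + infsum (v (tilt \<nu> f)) UNIV"
    by (intro infsum_add v assms)
  finally show ?thesis
    using v(2)[OF assms(1)] v(2)[OF assms(2)] by (simp add: n_def algebra_simps)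
qed

section \<open>Consequences of membership in \<open>class_Q\<close>\<close>

lemma lp_norm_1_leD:
  assumes "lp_norm 1 f \<le> ennreal B" "0 \<le> B"
  shows "(\<lambda>y. \<bar>f y\<bar>) summable_on UNIV" "(\<Sum>\<^sub>\<infinity>y. \<bar>f y\<bar>) \<le> B"
proof -
  show s: "(\<lambda>y. \<bar>f y\<bar>) summable_on UNIV"
    using assms by (auto simp: lp_norm_def top_unique split: if_splits)
  have "ennreal (\<Sum>\<^sub>\<infinity>y. \<bar>f y\<bar>) \<le> ennreal B"
    using assms s by (simp add: lp_norm_def infsum_nonneg)
  then show "(\<Sum>\<^sub>\<infinity>y. \<bar>f y\<bar>) \<le> B" using assms(2) by simp
qed

lemma class_Q_moment_bound:
  assumes "(Q, g) \<in> class_Q M K \<zeta>" "0 \<le> M"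
  shows "moment_bound \<zeta> (2 * M) Q"
proof -
  have "lp_norm 1 Q \<le> ennreal M" "lp_norm 1 (\<lambda>y. norm (emb y) powr (2 + \<zeta>) * Q y) \<le> ennreal M"
    using assms(1) by (auto simp: class_Q_def)
  note * = lp_norm_1_leD[OF this(1) assms(2)] lp_norm_1_leD[OF this(2) assms(2)]
  have eq: "\<bar>Q y\<bar> * (1 + norm (emb y) powr (2 + \<zeta>)) = \<bar>Q y\<bar> + \<bar>norm (emb y) powr (2 + \<zeta>) * Q y\<bar>" for y
    by (simp add: abs_mult algebra_simps)
  show ?thesis
    unfolding moment_bound_def eq using * by (auto simp: infsum_add intro!: summable_on_add)
qed

text \<open>For k = e * e_1 the Fourier difference equals \<sigma> e^2/2 up to an error 6 M e^(2+a),
  where \<sigma> is the second moment. Dividing the infrared bound by e^2 and letting e tend to 0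
  leaves K <= \<sigma>/2.\<close>

lemma class_Q_infrared:
  assumes Q: "(Q, g) \<in> class_Q M K \<zeta>" and sym: "lattice_symmetric Q"
    and "0 \<le> M" "0 < \<zeta>"
  shows "2 * K \<le> second_moment i1 Q"
proof -
  define a where "a = min \<zeta> 2"
  have a: "0 < a" "a \<le> 2" "a \<le> \<zeta>" using assms by (auto simp: a_def)
  have mb: "moment_bound \<zeta> (2 * M) Q" by (rule class_Q_moment_bound[OF Q \<open>0 \<le> M\<close>])
  have absQ: "(\<lambda>y. \<bar>Q y\<bar>) summable_on UNIV"
    using Q \<open>0 \<le> M\<close> lp_norm_1_leD(1) by (auto simp: class_Q_def)
  have sQ: "Q summable_on UNIV"
    by (rule infsum_dominated(1)[OF absQ]) simp
  have ineq: "K \<le> second_moment i1 Q / 2 + 6 * M * e powr a" if e: "0 < e" "e \<le> pi" for e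
  proof -
    define k :: "real ^ 'a" where "k = e *\<^sub>R axis i1 1"
    have nk: "norm k = e" using e by (simp add: k_def)
    have csum: "(\<lambda>y. complex_of_real (Q y) * exp (- \<i> * complex_of_real (k \<bullet> emb y))) summable_on UNIV" for k :: "real ^ 'a"
      using absQ unfolding summable_on_iff_abs_summable_on_complex
      by (simp add: norm_mult)
    have Re_four: "Re (fourier Q k) = (\<Sum>\<^sub>\<infinity>y. Q y * cos (k \<bullet> emb y))" for k :: "real ^ 'a"
      unfolding fourier_def
      using infsum_Re[OF csum[of k]] by (simp add: Re_exp)
    have scos: "(\<lambda>y. Q y * cos (k \<bullet> emb y)) summable_on UNIV"
      by (rule infsum_dominated(1)[OF absQ]) (auto simp: abs_mult intro: mult_left_le)
    have "\<forall>i. - pi \<le> k $ i \<and> k $ i \<le> pi" using e by (auto simp: k_def axis_def)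
    then have "K * (norm k)\<^sup>2 \<le> Re (fourier Q 0 - fourier Q k)"
      using Q unfolding class_Q_def by blast
    then have K: "K * e\<^sup>2 \<le> infsum Q UNIV - (\<Sum>\<^sub>\<infinity>y. Q y * cos (k \<bullet> emb y))"
      by (simp add: Re_four nk)
    define R where "R y = Q y * (1 - cos (k \<bullet> emb y) - (k \<bullet> emb y)\<^sup>2 / 2)" for y
    have "((\<lambda>y. Q y + (Q y * cos (k \<bullet> emb y)) * (-1) + (Q y * (k \<bullet> emb y)\<^sup>2) * (-1/2)) has_sum
       (infsum Q UNIV + (\<Sum>\<^sub>\<infinity>y. Q y * cos (k \<bullet> emb y)) * (-1) + (second_moment i1 Q * (norm k)\<^sup>2) * (-1/2))) UNIV"
      using a by (intro has_sum_add has_sum_cmult_left has_sum_infsum sQ scos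
         has_sum_inner_square[OF mb sym]) auto
    moreover have "R = (\<lambda>y. Q y + (Q y * cos (k \<bullet> emb y)) * (-1) + (Q y * (k \<bullet> emb y)\<^sup>2) * (-1/2))"
      by (simp add: R_def algebra_simps fun_eq_iff)
    ultimately have R: "infsum R UNIV = infsum Q UNIV - (\<Sum>\<^sub>\<infinity>y. Q y * cos (k \<bullet> emb y)) - second_moment i1 Q * e\<^sup>2 / 2"
      by (simp add: infsumI nk)
    have "\<bar>infsum R UNIV\<bar> \<le> (3 * e powr (2 + a)) * (2 * M)"
    proof (rule moment_bound_dominated(2)[OF mb, of _ "2 + a"])
      fix y
      have "\<bar>1 - cos (k \<bullet> emb y) - (k \<bullet> emb y)\<^sup>2 / 2\<bar> \<le> 3 * \<bar>k \<bullet> emb y\<bar> powr (2 + a)"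
        using a by (intro cos_taylor_bound) auto
      also have "\<dots> \<le> 3 * (norm k powr (2 + a) * norm (emb y) powr (2 + a))"
        using a by (intro mult_left_mono abs_inner_le_norm_powr) auto
      finally have "\<bar>R y\<bar> \<le> \<bar>Q y\<bar> * (3 * (norm k powr (2 + a) * norm (emb y) powr (2 + a)))"
        unfolding R_def abs_mult by (intro mult_left_mono) auto
      then show "\<bar>R y\<bar> \<le> (3 * e powr (2 + a)) * (\<bar>Q y\<bar> * norm (emb y) powr (2 + a))"
        by (simp add: nk mult_ac)
    qed (use a in auto)
    also have "\<dots> = 6 * M * e powr (2 + a)" by simp
    finally have "K * e\<^sup>2 \<le> second_moment i1 Q * e\<^sup>2 / 2 + 6 * M * e powr (2 + a)"
      using R K by linarith
    also have "e powr (2 + a) = e powr a * e\<^sup>2" using e by (simp add: powr_add)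
    finally have "K * e\<^sup>2 \<le> (second_moment i1 Q / 2 + 6 * M * e powr a) * e\<^sup>2" by (simp add: algebra_simps)
    then show ?thesis using e by simp
  qed
  \<comment> \<open>Positivity of \<open>a\<close> makes \<open>e powr a\<close> converge to
    \<open>0 powr a\<close>, which is 0.\<close>
  have "((\<lambda>e. second_moment i1 Q / 2 + 6 * M * e powr a) \<longlongrightarrow> second_moment i1 Q / 2 + 6 * M * 0 powr a) (at_right 0)"
    using a by (intro tendsto_intros) (auto simp: eventually_at_right_less intro: eventually_at_rightI[of 0 1])
  moreover have "\<forall>\<^sub>F e in at_right 0. K \<le> second_moment i1 Q / 2 + 6 * M * e powr a"
    using ineq by (intro eventually_at_rightI[of 0 pi]) auto
  ultimately have "K \<le> second_moment i1 Q / 2 + 6 * M * 0 powr a"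
    by (intro tendsto_lowerbound[of _ _ "at_right 0"]) auto
  then show ?thesis by simp
qed

subsection \<open>Boundary of the domain\<close>

text \<open>The shear (x, y) -> (x - y, y) turns the double sum into that of a product. Exchanging
  sums is justified because summable real families are absolutely summable.\<close>

lemma infsum_convolution:
  fixes f g :: "'a::ab_group_add \<Rightarrow> real"
  assumes "f summable_on UNIV" "g summable_on UNIV"
  shows "(\<Sum>\<^sub>\<infinity>x. \<Sum>\<^sub>\<infinity>y. f (x - y) * g y) = infsum f UNIV * infsum g UNIV"
    and "(\<lambda>x. \<Sum>\<^sub>\<infinity>y. f (x - y) * g y) summable_on UNIV"
proof -
  define p where "p = (\<lambda>(u, v). f u * g v)"
  define \<phi> :: "'a \<times> 'a \<Rightarrow> 'a \<times> 'a" where "\<phi> = (\<lambda>(x, y). (x - y, y))"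
  have \<phi>: "bij_betw \<phi> (UNIV \<times> UNIV) (UNIV \<times> UNIV)"
    by (rule bij_betw_byWitness[of _ "\<lambda>(x, y). (x + y, y)"]) (auto simp: \<phi>_def)
  have p: "p summable_on UNIV \<times> UNIV"
  proof -
    have "(\<lambda>y. norm (f y)) summable_on UNIV" "(\<lambda>y. norm (g y)) summable_on UNIV"
      using assms summable_on_iff_abs_summable_on_real by blast+
    then have "(\<lambda>z. norm (p z)) summable_on UNIV \<times> UNIV"
      unfolding Infinite_Sum.abs_summable_on_Sigma_iff
      by (auto simp: p_def norm_mult abs_mult infsum_cmult_right' infsum_cmult_left' infsum_nonneg
          intro!: summable_on_cmult_right summable_on_cmult_left)
    then show ?thesis using summable_on_iff_abs_summable_on_real by blast
  qed
  have p\<phi>: "(\<lambda>z. p (\<phi> z)) summable_on UNIV \<times> UNIV"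
    using summable_on_reindex_bij_betw[OF \<phi>] p by blast
  show "(\<lambda>x. \<Sum>\<^sub>\<infinity>y. f (x - y) * g y) summable_on UNIV"
    using summable_on_Sigma_banach[of "\<lambda>x y. f (x - y) * g y" UNIV "\<lambda>_. UNIV"] p\<phi>
    by (simp add: p_def \<phi>_def case_prod_unfold)
  have "(\<Sum>\<^sub>\<infinity>x. \<Sum>\<^sub>\<infinity>y. f (x - y) * g y) = infsum (\<lambda>z. p (\<phi> z)) (UNIV \<times> UNIV)"
    using infsum_Sigma_banach[OF p\<phi>] by (simp add: p_def \<phi>_def)
  also have "\<dots> = infsum p (UNIV \<times> UNIV)"
    by (rule infsum_reindex_bij_betw[OF \<phi>])
  also have "\<dots> = (\<Sum>\<^sub>\<infinity>u. \<Sum>\<^sub>\<infinity>v. f u * g v)"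
    using infsum_Sigma_banach[OF p] by (simp add: p_def)
  also have "\<dots> = infsum f UNIV * infsum g UNIV"
    by (simp add: infsum_cmult_right' infsum_cmult_left')
  finally show "(\<Sum>\<^sub>\<infinity>x. \<Sum>\<^sub>\<infinity>y. f (x - y) * g y) = infsum f UNIV * infsum g UNIV" .
qed

lemma tilt_conv: "tilt \<mu> (conv f g) x = (\<Sum>\<^sub>\<infinity>y. tilt \<mu> f (x - y) * tilt \<mu> g y)"
proof -
  have "f (x - y) * g y * exp (\<mu> \<bullet> emb x) = tilt \<mu> f (x - y) * tilt \<mu> g y" for y
  proof -
    have "emb x = emb (x - y) + emb y" by (simp add: emb_def vec_eq_iff)
    then show ?thesis by (simp add: tilt_def inner_add_right exp_add)
  qed
  then show ?thesis
    unfolding tilt_def[of _ "conv f g"] conv_def infsum_cmult_left'[symmetric] by (simp only:)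
qed

text \<open>Tilting commutes with convolution because exp(\<mu>.x) is multiplicative. Summing the
  tilted recursion therefore gives \<chi> = H + F \<chi>, with H and F the masses of the tilted h
  and J.\<close>

lemma susceptibility_equation:
  assumes eq: "\<And>x. S x = h x + conv J S x"
    and "tilt \<mu> S summable_on UNIV" "tilt \<mu> J summable_on UNIV" "tilt \<mu> h summable_on UNIV"
  shows "infsum (tilt \<mu> S) UNIV * (1 - infsum (tilt \<mu> J) UNIV) = infsum (tilt \<mu> h) UNIV"
proof -
  have "tilt \<mu> S x = tilt \<mu> h x + (\<Sum>\<^sub>\<infinity>y. tilt \<mu> J (x - y) * tilt \<mu> S y)" for x
    unfolding tilt_conv[symmetric] using eq[of x] by (simp add: tilt_def distrib_right)
  then have "tilt \<mu> S = (\<lambda>x. tilt \<mu> h x + (\<Sum>\<^sub>\<infinity>y. tilt \<mu> J (x - y) * tilt \<mu> S y))" by blast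
  then have "infsum (tilt \<mu> S) UNIV = infsum (tilt \<mu> h) UNIV + infsum (tilt \<mu> J) UNIV * infsum (tilt \<mu> S) UNIV"
    using infsum_add[OF assms(4) infsum_convolution(2)[OF assms(3,2)]]
    by (simp add: infsum_convolution(1)[OF assms(3,2)])
  then show ?thesis by (simp add: algebra_simps)
qed

text \<open>If the mass were not 1, the susceptibility would stay bounded along a sequence in \<^const>\<open>Omega\<close>
  converging to \<open>\<mu>\<close>, hence be finite at \<open>\<mu>\<close> by lower semicontinuity.\<close>

lemma infsum_tilt_eq_1:
  fixes S J h :: "int ^ 'd \<Rightarrow> real"
  assumes S: "\<And>x. S x \<ge> 0" and eq: "\<And>x. S x = h x + conv J S x"
    and Q: "\<And>\<mu>. \<mu> \<in> closure (Omega S) \<Longrightarrow> (tilt \<mu> J, tilt \<mu> h) \<in> class_Q M K \<zeta>"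
    and "0 \<le> M" "0 \<le> \<zeta>"
    and \<mu>: "\<mu> \<in> closure (Omega S)" "\<mu> \<notin> Omega S"
  shows "infsum (tilt \<mu> J) UNIV = 1"
proof (rule ccontr)
  define F where "F \<nu> = infsum (tilt \<nu> J) UNIV" for \<nu>
  \<comment> \<open>Half the gap: once \<open>F (u n)\<close> is within \<open>c\<close> of
    \<open>F \<mu>\<close>, its distance from 1 is still at least \<open>c\<close>, which gives the
    susceptibility bound \<open>M / c\<close>.\<close>
  define c where "c = \<bar>1 - F \<mu>\<bar> / 2"
  assume "infsum (tilt \<mu> J) UNIV \<noteq> 1"
  then have c: "c > 0" by (simp add: c_def F_def)
  have mb: "moment_bound \<zeta> (2 * M) (tilt \<nu> J)" if "\<nu> \<in> closure (Omega S)" for \<nu>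
    using class_Q_moment_bound[OF Q[OF that] \<open>0 \<le> M\<close>] .
  obtain u where u: "\<And>n. u n \<in> Omega S" "u \<longlonglongrightarrow> \<mu>"
    using \<mu>(1) unfolding closure_sequential by blast
  have uc: "u n \<in> closure (Omega S)" for n using u(1) closure_subset by blast
  have "(\<lambda>n. F (u n) - F \<mu>) \<longlonglongrightarrow> 0"
  proof (rule Lim_null_comparison)
    show "\<forall>\<^sub>F n in sequentially. norm (F (u n) - F \<mu>) \<le> 2 * (2 * M) * norm (u n - \<mu>)"
      using infsum_tilt_lipschitz[OF mb[OF uc] mb[OF \<mu>(1)] \<open>0 \<le> \<zeta>\<close>] by (simp add: F_def)
    show "(\<lambda>n. 2 * (2 * M) * norm (u n - \<mu>)) \<longlonglongrightarrow> 0"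
      using tendsto_norm_zero[OF LIM_zero[OF u(2)]] by (intro tendsto_mult_right_zero)
  qed
  then have "\<forall>\<^sub>F n in sequentially. \<bar>F (u n) - F \<mu>\<bar> < c"
    using c by (auto dest!: tendstoD[of _ 0 _ c])
  then have ev: "\<forall>\<^sub>F n in sequentially. infsum (tilt (u n) S) UNIV \<le> M / c"
  proof eventually_elim
    case (elim n)
    have sS: "tilt (u n) S summable_on UNIV" using u(1) Omega_iff_summable[of S, OF S] by blast
    have "lp_norm 1 (tilt (u n) h) \<le> ennreal M" using Q[OF uc] by (auto simp: class_Q_def)
    note h = lp_norm_1_leD[OF this \<open>0 \<le> M\<close>]
    have sh: "tilt (u n) h summable_on UNIV" "\<bar>infsum (tilt (u n) h) UNIV\<bar> \<le> M"
      using infsum_dominated[OF h(1), of "tilt (u n) h"] h(2) by auto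
    have "infsum (tilt (u n) S) UNIV * (1 - F (u n)) = infsum (tilt (u n) h) UNIV"
      unfolding F_def
      by (rule susceptibility_equation[OF eq sS moment_bound_summable[OF mb[OF uc]] sh(1)])
    then have "\<bar>infsum (tilt (u n) S) UNIV\<bar> * \<bar>1 - F (u n)\<bar> \<le> M"
      using sh(2) by (metis abs_mult)
    moreover have "c \<le> \<bar>1 - F (u n)\<bar>" using elim unfolding c_def by (simp add: abs_if split: if_splits)
    ultimately have "\<bar>infsum (tilt (u n) S) UNIV\<bar> * c \<le> M"
      by (meson abs_ge_zero mult_left_mono order_trans)
    then show ?case using c by (simp add: pos_le_divide_eq)
      (smt (verit) mult_right_mono)
  qed
  have "tilt \<mu> S summable_on UNIV"
  proof (rule nonneg_bdd_above_summable_on)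
    show "bdd_above (sum (tilt \<mu> S) ` {A. A \<subseteq> UNIV \<and> finite A})"
    proof (rule bdd_aboveI2)
      fix A :: "(int ^ 'd) set" assume "A \<in> {A. A \<subseteq> UNIV \<and> finite A}"
      then have A: "finite A" by simp
      \<comment> \<open>A finite sum is continuous in the tilt, so each partial sum at
        \<open>\<mu>\<close> inherits the bound \<open>M / c\<close>, which does not depend on
        \<open>A\<close>.\<close>
      have "(\<lambda>n. sum (tilt (u n) S) A) \<longlonglongrightarrow> sum (tilt \<mu> S) A"
        unfolding tilt_def by (intro tendsto_intros u)
      moreover have "\<forall>\<^sub>F n in sequentially. sum (tilt (u n) S) A \<le> M / c"
        using ev
      proof eventually_elim
        case (elim n)
        have "sum (tilt (u n) S) A \<le> infsum (tilt (u n) S) UNIV"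
          using u(1) Omega_iff_summable[of S, OF S] A S by (intro finite_sum_le_infsum) (auto simp: tilt_def)
        with elim show ?case by simp
      qed
      ultimately show "sum (tilt \<mu> S) A \<le> M / c"
        by (rule tendsto_upperbound) simp
    qed
  qed (simp add: tilt_def S)
  then show False using \<mu>(2) Omega_iff_summable[of S, OF S] by blast
qed

section \<open>Geometry of the domain: rays, mass and maximisers\<close>

lemma norm_le_sum_components:
  fixes \<mu> :: "real ^ 'd" and r :: real
  assumes "\<And>i. \<bar>\<mu> $ i\<bar> \<le> r"
  shows "norm \<mu> \<le> CARD('d) * r"
  using norm_le_l1_cart[of \<mu>] sum_bounded_above[of UNIV "\<lambda>i. \<bar>\<mu> $ i\<bar>" r] assms by simp

context
  fixes S :: "int ^ 'd \<Rightarrow> real" and i1 :: 'd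
  assumes S: "\<And>x. S x \<ge> 0" and A1: "assumption1 i1 S"
begin

lemma Omega_assms: "lattice_symmetric S" "open (Omega S)" "0 \<in> Omega S"
  using A1 by (auto simp: assumption1_def)

lemma scaleR_in_Omega:
  assumes "t *\<^sub>R v \<in> Omega S" "0 \<le> s" "s \<le> t"
  shows "s *\<^sub>R v \<in> Omega S"
proof (cases "t = 0")
  case True
  with assms show ?thesis by simp
next
  case False
  with assms have "(1 - s / t) *\<^sub>R 0 + (s / t) *\<^sub>R (t *\<^sub>R v) \<in> Omega S"
    by (intro convexD[OF convex_Omega[of S, OF S]] Omega_assms) auto
  with False show ?thesis by simp
qed

text \<open>A coordinate larger than \<open>\<mu>1\<close> would, by projection onto the axis and
  convexity with 0, put the excluded axis point into the domain.\<close>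

lemma bounded_Omega: "bounded (Omega S)"
proof -
  obtain \<mu>1 where \<mu>1: "0 < \<mu>1" "\<mu>1 *\<^sub>R axis i1 1 \<notin> Omega S"
    using A1 unfolding assumption1_def by blast
  have "norm \<mu> \<le> CARD('d) * \<mu>1" if "\<mu> \<in> Omega S" for \<mu>
  proof (rule norm_le_sum_components, rule ccontr)
    fix i assume "\<not> \<bar>\<mu> $ i\<bar> \<le> \<mu>1"
    then have "\<mu>1 *\<^sub>R axis i1 1 \<in> Omega S"
      using scaleR_in_Omega[OF abs_component_axis_in_Omega[of S, OF S Omega_assms(1) that, of i i1], of \<mu>1] \<mu>1 by simp
    with \<mu>1 show False by simp
  qed
  then show ?thesis unfolding bounded_iff by blast
qed

text \<open>Openness makes the ray meet the domain in a half-open segment. Its endpoint lies in the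
  closure but outside the domain, exactly where \<open>infsum_tilt_eq_1\<close> applies.\<close>

lemma ray_exits_Omega:
  assumes "v \<noteq> 0"
  obtains t where "0 < t" "t *\<^sub>R v \<in> closure (Omega S)"
    "\<And>s. 0 \<le> s \<Longrightarrow> s *\<^sub>R v \<in> Omega S \<longleftrightarrow> s < t"
proof -
  obtain t where t: "0 < t" "t *\<^sub>R v \<in> frontier (Omega S)" "\<And>s. 0 \<le> s \<Longrightarrow> s < t \<Longrightarrow> s *\<^sub>R v \<in> Omega S"
    using ray_to_frontier[OF bounded_Omega _ assms, of 0] Omega_assms by (auto simp: interior_open)
  have notin: "t *\<^sub>R v \<notin> Omega S"
    using t(2) Omega_assms by (simp add: frontier_def interior_open)
  show ?thesis
  proof
    show "t *\<^sub>R v \<in> closure (Omega S)" using t(2) by (simp add: frontier_def)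
    fix s :: real assume "0 \<le> s"
    show "s *\<^sub>R v \<in> Omega S \<longleftrightarrow> s < t"
      using scaleR_in_Omega[of s v t] t notin \<open>0 \<le> s\<close> by (meson less_eq_real_def not_le)
  qed fact
qed

text \<open>The set whose supremum defines the mass is \<open>{0..<t}\<close>, with t the exit time
  along the first axis; so the mass is that exit time.\<close>

lemma mass_boundary:
  shows "0 < mass i1 S" "mass i1 S *\<^sub>R axis i1 1 \<in> closure (Omega S)" "mass i1 S *\<^sub>R axis i1 1 \<notin> Omega S"
    and "\<mu> \<in> Omega S \<Longrightarrow> \<bar>\<mu> $ i\<bar> \<le> mass i1 S"
proof -
  obtain t where t: "0 < t" "t *\<^sub>R axis i1 1 \<in> closure (Omega S)"
    "\<And>s. 0 \<le> s \<Longrightarrow> s *\<^sub>R axis i1 1 \<in> Omega S \<longleftrightarrow> s < t"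
    using ray_exits_Omega[of "axis i1 1"] by (auto simp: axis_eq_0_iff)
  have "{s. 0 \<le> s \<and> chi S (s *\<^sub>R axis i1 1) < \<infinity>} = {0..<t}"
    using t(3) by (auto simp: Omega_def)
  then have m: "mass i1 S = t" using t(1) unfolding mass_def by simp
  show "0 < mass i1 S" "mass i1 S *\<^sub>R axis i1 1 \<in> closure (Omega S)" "mass i1 S *\<^sub>R axis i1 1 \<notin> Omega S"
    using t by (auto simp: m)
  show "\<bar>\<mu> $ i\<bar> \<le> mass i1 S" if "\<mu> \<in> Omega S"
    using abs_component_axis_in_Omega[of S, OF S Omega_assms(1) that, of i i1] t(3)[of "\<bar>\<mu> $ i\<bar>"]
    by (simp add: m)
qed

text \<open>A crude comparison only: it converts error terms in the norm of \<mu> into error terms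
  in the mass.\<close>

lemma norm_le_mass:
  assumes "\<mu> \<in> closure (Omega S)"
  shows "norm \<mu> \<le> CARD('d) * mass i1 S"
proof -
  have "Omega S \<subseteq> cball 0 (CARD('d) * mass i1 S)"
    using norm_le_sum_components[OF mass_boundary(4)] by auto
  then have "closure (Omega S) \<subseteq> cball 0 (CARD('d) * mass i1 S)"
    by (intro closure_minimal) auto
  with assms show ?thesis by auto
qed

text \<open>Compactness supplies a maximiser, so the choice in \<open>arg_max_on\<close> returns
  one. It cannot lie in the open domain, since a small step along \<open>u\<close> would increase
  the inner product.\<close>

lemma mu_dir_maximises:
  assumes "u \<noteq> 0"
  shows "mu_dir S u \<in> closure (Omega S)" "mu_dir S u \<notin> Omega S"
    and "\<And>\<mu>. \<mu> \<in> closure (Omega S) \<Longrightarrow> \<mu> \<bullet> u \<le> mu_dir S u \<bullet> u"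
proof -
  have "compact (closure (Omega S))" "closure (Omega S) \<noteq> {}"
    using bounded_Omega Omega_assms(3) closure_subset by auto
  then obtain \<nu> where "\<nu> \<in> closure (Omega S)" "\<forall>\<mu>\<in>closure (Omega S). \<mu> \<bullet> u \<le> \<nu> \<bullet> u"
    using continuous_attains_sup[of "closure (Omega S)" "\<lambda>\<mu>. \<mu> \<bullet> u"]
    using continuous_on_inner[OF continuous_on_id continuous_on_const, of "closure (Omega S)" u] by blast
  then have "is_arg_max (\<lambda>\<mu>. \<mu> \<bullet> u) (\<lambda>\<mu>. \<mu> \<in> closure (Omega S)) \<nu>"
    by (simp add: is_arg_max_linorder)
  then have *: "is_arg_max (\<lambda>\<mu>. \<mu> \<bullet> u) (\<lambda>\<mu>. \<mu> \<in> closure (Omega S)) (mu_dir S u)"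
    unfolding mu_dir_def arg_max_on_def arg_max_def by (rule someI)
  then show "mu_dir S u \<in> closure (Omega S)"
    and max: "\<And>\<mu>. \<mu> \<in> closure (Omega S) \<Longrightarrow> \<mu> \<bullet> u \<le> mu_dir S u \<bullet> u"
    by (auto simp: is_arg_max_linorder)
  show "mu_dir S u \<notin> Omega S"
  proof
    assume "mu_dir S u \<in> Omega S"
    then obtain e where e: "0 < e" "cball (mu_dir S u) e \<subseteq> Omega S"
      using Omega_assms(2) open_contains_cball by blast
    have "mu_dir S u + (e / norm u) *\<^sub>R u \<in> cball (mu_dir S u) e"
      using e assms by (simp add: dist_norm)
    then have "mu_dir S u + (e / norm u) *\<^sub>R u \<in> closure (Omega S)"
      using e(2) closure_subset by blast
    from max[OF this] have "(e / norm u) * (u \<bullet> u) \<le> 0" by (simp add: inner_add_left)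
    moreover have "0 < e / norm u" "0 < u \<bullet> u" using e assms by auto
    ultimately show False by (metis mult_pos_pos not_le)
  qed
qed

end

section \<open>Comparison of the boundary with a sphere, and the norm\<close>

lemma norm_boundary_estimate:
  fixes S J h :: "int ^ 'd \<Rightarrow> real" and i1 :: 'd
  assumes S: "\<And>x. S x \<ge> 0" and A1: "assumption1 i1 S" and A2: "assumption2 S J h"
    and Q: "\<And>\<mu>. \<mu> \<in> closure (Omega S) \<Longrightarrow> (tilt \<mu> J, tilt \<mu> h) \<in> class_Q M K \<zeta>"
    and pos: "0 < M" "0 < K" "0 < \<zeta>"
    and \<mu>: "\<mu> \<in> closure (Omega S)" "\<mu> \<notin> Omega S"
  shows "\<bar>norm \<mu> - mass i1 S\<bar>
    \<le> 2 * M * (CARD('d) powr (2 + min \<zeta> 2) + 1) / K * mass i1 S powr min \<zeta> 2 * mass i1 S"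
proof -
  define a where "a = min \<zeta> 2"
  define m where "m = mass i1 S"
  define n :: real where "n = CARD('d)"
  define \<sigma> where "\<sigma> = second_moment i1 J"
  have a: "0 < a" "a \<le> 2" "a \<le> \<zeta>" using pos by (auto simp: a_def)
  note mass = mass_boundary[of S, OF S A1, folded m_def]
  have eq: "\<And>x. S x = h x + conv J S x" and symJ: "lattice_symmetric J"
    using A2 by (auto simp: assumption2_def)
  have 0: "0 \<in> closure (Omega S)"
    using Omega_assms(3)[of S, OF S A1] closure_subset by blast
  have mb: "moment_bound \<zeta> (2 * M) (tilt \<nu> J)" if "\<nu> \<in> closure (Omega S)" for \<nu>
    using class_Q_moment_bound[OF Q[OF that]] pos by simp
  have \<sigma>: "2 * K \<le> \<sigma>"
    unfolding \<sigma>_def using class_Q_infrared[of J _ M K \<zeta> i1] Q[OF 0] symJ pos by simp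
  \<comment> \<open>At a boundary point the tilted mass is 1, so 1 - F(0) is approximated by
    \<sigma>/2 times the squared norm. The left term is the same for all boundary points and cancels
    between \<mu> and m e_1.\<close>
  have expansion: "\<bar>1 - infsum J UNIV - \<sigma> * (norm \<nu>)\<^sup>2 / 2\<bar> \<le> 2 * M * norm \<nu> powr (2 + a)"
    if "\<nu> \<in> closure (Omega S)" "\<nu> \<notin> Omega S" for \<nu>
  proof -
    have "infsum (tilt \<nu> J) UNIV = 1"
      by (rule infsum_tilt_eq_1[of S, OF S eq Q]) (use pos that in auto)
    then show ?thesis
      using infsum_tilt_expansion[OF symJ _ mb[OF that(1)], of a i1] mb[OF 0] a
      by (simp add: \<sigma>_def)
  qed
  have "norm \<mu> powr (2 + a) \<le> (n * m) powr (2 + a)"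
    using norm_le_mass[of S, OF S A1 \<mu>(1)] a unfolding n_def m_def by (intro powr_mono2) auto
  also have "\<dots> = n powr (2 + a) * m powr (2 + a)"
    by (rule powr_mult)
  finally have *: "M * norm \<mu> powr (2 + a) \<le> M * (n powr (2 + a) * m powr (2 + a))"
    using pos by simp
  have "\<bar>1 - infsum J UNIV - \<sigma> * m\<^sup>2 / 2\<bar> \<le> 2 * (M * m powr (2 + a))"
    using expansion[OF mass(2,3)] mass(1) by simp
  moreover have "\<bar>1 - infsum J UNIV - \<sigma> * (norm \<mu>)\<^sup>2 / 2\<bar> \<le> 2 * (M * norm \<mu> powr (2 + a))"
    using expansion[OF \<mu>] by simp
  ultimately have "\<bar>\<sigma> * (norm \<mu>)\<^sup>2 / 2 - \<sigma> * m\<^sup>2 / 2\<bar>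
      \<le> 2 * (M * (n powr (2 + a) * m powr (2 + a))) + 2 * (M * m powr (2 + a))"
    using * by linarith
  also have "\<sigma> * (norm \<mu>)\<^sup>2 / 2 - \<sigma> * m\<^sup>2 / 2 = \<sigma> / 2 * ((norm \<mu>)\<^sup>2 - m\<^sup>2)"
    by (simp add: algebra_simps)
  also have "2 * (M * (n powr (2 + a) * m powr (2 + a))) + 2 * (M * m powr (2 + a))
      = 2 * M * (n powr (2 + a) + 1) * m powr a * m * m"
    using mass(1) by (simp add: powr_add power2_eq_square algebra_simps)
  finally have bound: "\<sigma> / 2 * \<bar>(norm \<mu>)\<^sup>2 - m\<^sup>2\<bar> \<le> 2 * M * (n powr (2 + a) + 1) * m powr a * m * m"
    using \<sigma> pos by (simp add: abs_mult)
  \<comment> \<open>The difference of squares is divided by its factor |\<mu>| + m; replacing that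
    factor by its lower bound m avoids any lower bound on |\<mu>|.\<close>
  have "K * (\<bar>norm \<mu> - m\<bar> * m) \<le> K * (\<bar>norm \<mu> - m\<bar> * (norm \<mu> + m))"
    using pos by (intro mult_left_mono) auto
  also have "\<bar>norm \<mu> - m\<bar> * (norm \<mu> + m) = \<bar>(norm \<mu>)\<^sup>2 - m\<^sup>2\<bar>"
  proof -
    have "(norm \<mu>)\<^sup>2 - m\<^sup>2 = (norm \<mu> - m) * (norm \<mu> + m)"
      by (simp add: power2_eq_square algebra_simps)
    then show ?thesis using mass(1) by (simp add: abs_mult)
  qed
  also have "K * \<bar>(norm \<mu>)\<^sup>2 - m\<^sup>2\<bar> \<le> \<sigma> / 2 * \<bar>(norm \<mu>)\<^sup>2 - m\<^sup>2\<bar>"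
    using \<sigma> by (intro mult_right_mono) auto
  finally have "(K * \<bar>norm \<mu> - m\<bar>) * m \<le> (2 * M * (n powr (2 + a) + 1) * m powr a * m) * m"
    using bound by (simp add: mult.assoc)
  then have "K * \<bar>norm \<mu> - m\<bar> \<le> 2 * M * (n powr (2 + a) + 1) * m powr a * m"
    using mass(1) by simp
  then have "\<bar>norm \<mu> - m\<bar> \<le> 2 * M * (n powr (2 + a) + 1) * m powr a * m / K"
    using pos by (simp add: pos_le_divide_eq mult.commute)
  then show ?thesis by (simp add: a_def m_def n_def)
qed

lemma norm_S_estimate:
  fixes S J h :: "int ^ 'd \<Rightarrow> real" and i1 :: 'd
  assumes S: "\<And>x. S x \<ge> 0" and A1: "assumption1 i1 S" and A2: "assumption2 S J h"
    and Q: "\<And>\<mu>. \<mu> \<in> closure (Omega S) \<Longrightarrow> (tilt \<mu> J, tilt \<mu> h) \<in> class_Q M K \<zeta>"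
    and pos: "0 < M" "0 < K" "0 < \<zeta>"
  shows "\<exists>\<epsilon>. norm_S i1 S x = norm x * (1 + \<epsilon>) \<and>
    \<bar>\<epsilon>\<bar> \<le> 2 * M * (CARD('d) powr (2 + min \<zeta> 2) + 1) / K * mass i1 S powr min \<zeta> 2"
proof (cases "x = 0")
  case True
  then show ?thesis using pos by (intro exI[of _ 0]) (simp add: norm_S_def)
next
  case False
  define u where "u = sgn x"
  define m where "m = mass i1 S"
  define b where "b = 2 * M * (CARD('d) powr (2 + min \<zeta> 2) + 1) / K * m powr min \<zeta> 2"
  \<comment> \<open>The support function of the closed domain in direction \<open>u\<close>. By
    homogeneity |x|_z = |x| w / m, so the relative error is w / m - 1.\<close>
  define w where "w = mu_dir S u \<bullet> u"
  have u: "u \<noteq> 0" "norm u = 1" "x = norm x *\<^sub>R u"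
    using False by (auto simp: u_def sgn_zero_iff norm_sgn sgn_div_norm)
  have m: "0 < m" unfolding m_def by (rule mass_boundary(1)[of S, OF S A1])
  have est: "\<bar>norm \<mu> - m\<bar> \<le> b * m" if "\<mu> \<in> closure (Omega S)" "\<mu> \<notin> Omega S" for \<mu>
    using norm_boundary_estimate[of S, OF S A1 A2 Q pos that] by (simp add: b_def m_def)
  note mu_dir = mu_dir_maximises[of S, OF S A1 u(1)]
  have "w \<le> norm (mu_dir S u)"
    using norm_cauchy_schwarz[of "mu_dir S u" u] u(2) by (simp add: w_def)
  with est[OF mu_dir(1,2)] have upper: "w \<le> m + b * m" by linarith
  obtain t where t: "0 < t" "t *\<^sub>R u \<in> closure (Omega S)" "t *\<^sub>R u \<notin> Omega S"
    using ray_exits_Omega[of S, OF S A1 u(1)] by (metis less_eq_real_def less_irrefl)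
  have "t \<le> w"
    using mu_dir(3)[OF t(2)] u(2) by (simp add: w_def dot_square_norm)
  with est[OF t(2,3)] t(1) u(2) have lower: "m - b * m \<le> w" by simp
  have "\<bar>w - m\<bar> \<le> b * m" using upper lower by linarith
  then have "\<bar>w / m - 1\<bar> \<le> b"
    using m by (simp add: abs_le_iff field_simps)
  moreover have "norm_S i1 S x = norm x * (1 + (w / m - 1))"
  proof -
    have "mu_dir S u \<bullet> x = norm x * w"
      by (subst u(3)) (simp add: w_def)
    then show ?thesis using False by (simp add: norm_S_def u_def[symmetric] m_def)
  qed
  ultimately show ?thesis unfolding b_def m_def by blast
qed

theorem theorem2p1:
  fixes S J h :: "real \<Rightarrow> int ^ 'd \<Rightarrow> real"
    and i1 :: 'd
    and zc \<delta> M K \<zeta> :: real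
  assumes "\<delta> > 0"
    and "\<And>z x. z \<in> {zc - \<delta>..<zc} \<Longrightarrow> S z x \<ge> 0"
    and "\<And>z. z \<in> {zc - \<delta>..<zc} \<Longrightarrow> assumption1 i1 (S z)"
    and "\<And>z. z \<in> {zc - \<delta>..<zc} \<Longrightarrow> assumption2 (S z) (J z) (h z)"
    and "((\<lambda>z. mass i1 (S z)) \<longlongrightarrow> 0) (at_left zc)"
    and "M > 0" and "K > 0" and "\<zeta> > 0"
    and "\<And>z \<mu>. z \<in> {zc - \<delta>..<zc} \<Longrightarrow> \<mu> \<in> closure (Omega (S z)) \<Longrightarrow>
           (tilt \<mu> (J z), tilt \<mu> (h z)) \<in> class_Q M K \<zeta>"
  shows "\<exists>C. \<forall>\<^sub>F z in at_left zc. \<forall>x. \<exists>\<epsilon>.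
           norm_S i1 (S z) x = norm x * (1 + \<epsilon>) \<and>
           \<bar>\<epsilon>\<bar> \<le> C * mass i1 (S z) powr (min \<zeta> 2)"
proof (intro exI)
  \<comment> \<open>The constant from \<open>norm_S_estimate\<close> involves only M, K, \<zeta> and
    the dimension, so one C serves all x and all z in the interval.\<close>
  have "\<forall>\<^sub>F z in at_left zc. z \<in> {zc - \<delta>..<zc}"
    using \<open>\<delta> > 0\<close> by (intro eventually_at_leftI[of "zc - \<delta>"]) auto
  then show "\<forall>\<^sub>F z in at_left zc. \<forall>x. \<exists>\<epsilon>.
      norm_S i1 (S z) x = norm x * (1 + \<epsilon>) \<and>
      \<bar>\<epsilon>\<bar> \<le> (2 * M * (CARD('d) powr (2 + min \<zeta> 2) + 1) / K) * mass i1 (S z) powr (min \<zeta> 2)"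
  proof eventually_elim
    case (elim z)
    show ?case
      by (rule allI, rule norm_S_estimate[of "S z" i1 "J z" "h z"]) (use assms elim in blast)+
  qed
qed

end
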